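(* Let $g:\mathbb{R}^d\to\mathbb{R}^d$ be differentiable with $g(x^\ast)=0$, let $R$ be a positive semidefinite $d\times d$ real matrix (not assumed invertible), and let $\alpha_M>0$. Assume there exist constants $\beta,\omega_L,M_I,\varepsilon_1>0$ such that for all $\alpha$ with $0<\alpha<\alpha_M$ and all $x\in B(x^\ast,\varepsilon_1)$: (1) $\|g'(x)-g'(y)\|\le\omega_L\|x-y\|$ for all $y\in B(x^\ast,\varepsilon_1)$; (2) $\alpha R+g'(x)$ is invertible; (3) $\|(\alpha R+g'(x))^{-1}\|\le M_I$; (4) $\|(\alpha R+g'(x))^{-1}(\alpha R)\|\le \dfrac{\alpha/\beta}{1+\alpha/\beta}$. Let $\varepsilon_E\in(0,\varepsilon_1]$ be a radius of local $q$-linear convergence of the error (as defined in the context), and assume further that there exist $\beta_S>0$ and $\varepsilon_3$ with $0<\varepsilon_3\le\varepsilon_E$ such that for all $\alpha$ with $0<\alpha<\alpha_M$ and all $x\in B(x^\ast,\varepsilon_3)$, $$\|(\alpha R)(\alpha R+g'(x))^{-1}\|\le\frac{\alpha/\beta_S}{1+\alpha/\beta_S}.$$ Then there is $\varepsilon_S>0$ such that for every starting point $x^0\in B(x^\ast,\varepsilon_S)$ and every sequence $(\alpha_n)_{n\ge0}$ with $0<\alpha_n<\alpha_M$ for all $n$, the sequence of residuals $g(x^n)$ defined by the iteration $$x^{n+1}-x^n=-(\alpha_nR+g'(x^n))^{-1}g(x^n),\qquad n\ge0,$$ converges $q$-linearly to zero.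
   Context: $\|\cdot\|$ is a fixed norm on $\mathbb{R}^d$ and also the induced operator norm on matrices; $g'(x)$ is the Jacobian of $g$ at $x$; $B(x^\ast,\varepsilon)=\{x:\|x-x^\ast\|<\varepsilon\}$. A sequence $(y^n)$ converges $q$-linearly to $y^\ast$ if $y^n\to y^\ast$ and there is $\rho\in(0,1)$ with $\|y^{n+1}-y^\ast\|\le\rho\|y^n-y^\ast\|$ for all $n$. A radius of local $q$-linear convergence of the error is a number $\varepsilon_E>0$ such that for every $x^0\in B(x^\ast,\varepsilon_E)$ and every sequence $(\alpha_n)$ in $(0,\alpha_M)$ the iteration $x^{n+1}=x^n-(\alpha_nR+g'(x^n))^{-1}g(x^n)$ converges $q$-linearly to $x^\ast$; under hypotheses (1)–(4) such a radius exists. *)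

theory Defs
  imports "HOL-Analysis.Analysis"
begin

text \<open>The library fixes the Euclidean norm on \<^typ>\<open>real ^ 'd\<close>; here the norm is an arbitrary
  parameter \<open>N\<close>.\<close>

definition is_norm :: "(real ^ 'd \<Rightarrow> real) \<Rightarrow> bool" where
  "is_norm N \<longleftrightarrow>
     (\<forall>x. 0 \<le> N x) \<and>
     (\<forall>x. N x = 0 \<longleftrightarrow> x = 0) \<and>
     (\<forall>c x. N (c *\<^sub>R x) = \<bar>c\<bar> * N x) \<and>
     (\<forall>x y. N (x + y) \<le> N x + N y)"

text \<open>The operator norm induced by \<open>N\<close>, in the form of the library's \<^const>\<open>onorm\<close>: the junk
  quotient at \<open>x = 0\<close> is \<open>0\<close> and does not affect the supremum.\<close>

definition op_norm :: "(real ^ 'd \<Rightarrow> real) \<Rightarrow> real ^ 'd ^ 'd \<Rightarrow> real" where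
  "op_norm N A = (SUP x. N (A *v x) / N x)"

definition norm_ball :: "(real ^ 'd \<Rightarrow> real) \<Rightarrow> real ^ 'd \<Rightarrow> real \<Rightarrow> (real ^ 'd) set" where
  "norm_ball N c r = {x. N (x - c) < r}"

text \<open>Positive semidefiniteness means nonnegativity of the quadratic form; symmetry is not
  required, so the symmetric positive semidefinite matrices are a special case.\<close>

definition pos_semidef :: "real ^ 'd ^ 'd \<Rightarrow> bool" where
  "pos_semidef R \<longleftrightarrow> (\<forall>x. 0 \<le> x \<bullet> (R *v x))"

abbreviation Jac :: "(real ^ 'd \<Rightarrow> real ^ 'd) \<Rightarrow> real ^ 'd \<Rightarrow> real ^ 'd ^ 'd" where
  "Jac g x \<equiv> jacobian g (at x)"

definition q_linear :: "(real ^ 'd \<Rightarrow> real) \<Rightarrow> (nat \<Rightarrow> real ^ 'd) \<Rightarrow> real ^ 'd \<Rightarrow> bool" where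
  "q_linear N y ystar \<longleftrightarrow>
     y \<longlonglongrightarrow> ystar \<and>
     (\<exists>\<rho>. 0 < \<rho> \<and> \<rho> < 1 \<and> (\<forall>n. N (y (Suc n) - ystar) \<le> \<rho> * N (y n - ystar)))"

primrec iterate ::
  "(real ^ 'd \<Rightarrow> real ^ 'd) \<Rightarrow> real ^ 'd ^ 'd \<Rightarrow> (nat \<Rightarrow> real) \<Rightarrow> real ^ 'd \<Rightarrow> nat \<Rightarrow> real ^ 'd" where
  "iterate g R \<alpha> x0 0 = x0"
| "iterate g R \<alpha> x0 (Suc n) =
     iterate g R \<alpha> x0 n
     - matrix_inv (\<alpha> n *\<^sub>R R + Jac g (iterate g R \<alpha> x0 n)) *v g (iterate g R \<alpha> x0 n)"

text \<open>\<^const>\<open>matrix_inv\<close> is total, so \<^const>\<open>iterate\<close> yields a sequence even when some step is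
  undefined; the following predicate says that all inverses in the iteration exist.\<close>

definition iteration_defined ::
  "(real ^ 'd \<Rightarrow> real ^ 'd) \<Rightarrow> real ^ 'd ^ 'd \<Rightarrow> (nat \<Rightarrow> real) \<Rightarrow> real ^ 'd \<Rightarrow> bool" where
  "iteration_defined g R \<alpha> x0 \<longleftrightarrow>
     (\<forall>n. invertible (\<alpha> n *\<^sub>R R + Jac g (iterate g R \<alpha> x0 n)))"

definition error_radius ::
  "(real ^ 'd \<Rightarrow> real) \<Rightarrow> (real ^ 'd \<Rightarrow> real ^ 'd) \<Rightarrow> real ^ 'd ^ 'd \<Rightarrow> real \<Rightarrow> real ^ 'd \<Rightarrow> real \<Rightarrow> bool"
where
  "error_radius N g R \<alpha>\<^sub>M xstar \<epsilon> \<longleftrightarrow>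
     0 < \<epsilon> \<and>
     (\<forall>x0 \<in> norm_ball N xstar \<epsilon>. \<forall>\<alpha>. (\<forall>n. 0 < \<alpha> n \<and> \<alpha> n < \<alpha>\<^sub>M) \<longrightarrow>
        iteration_defined g R \<alpha> x0 \<and> q_linear N (iterate g R \<alpha> x0) xstar)"

end

theory Submission
  imports Defs
begin

text \<open>
  A regularized Newton step \<open>h = - (\<alpha> R + g' x)\<inverse> g x\<close> cancels the linearization of \<open>g\<close> at \<open>x\<close> up
  to the regularization: writing \<open>g' x = (\<alpha> R + g' x) - \<alpha> R\<close> gives
  \<open>g x + g' x h = (\<alpha> R) (\<alpha> R + g' x)\<inverse> g x\<close>.  The last hypothesis bounds the matrix on the right by
  \<open>(\<alpha>/\<beta>\<^sub>S) / (1 + \<alpha>/\<beta>\<^sub>S)\<close>, which increases with \<open>\<alpha>\<close> and so stays below its value \<open>q < 1\<close> at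
  \<open>\<alpha>\<^sub>M\<close>.  The Lipschitz condition on \<open>g'\<close> makes the linearization error quadratic in \<open>h\<close>, and \<open>h\<close>
  is at most \<open>M\<^sub>I\<close> times the residual.  Hence one step maps a residual of size \<open>r\<close> to one of size at
  most \<open>(q + K M\<^sub>I\<^sup>2 r) r\<close>, for some constant \<open>K\<close> (\<open>residual_after_step\<close>), and this is a contraction
  as soon as \<open>r\<close> is small.

  It remains to keep all residuals small and all iterates in the region where the estimates hold.
  Both follow from \<open>q\<close>-linear convergence of the error: it makes the distance to \<open>x\<^sup>*\<close> decrease, so
  every ball around \<open>x\<^sup>*\<close> inside the convergence radius is invariant, and by continuity of \<open>g\<close> the
  residual is uniformly small on a small enough ball.

  The norm is an arbitrary one, whereas derivatives and limits refer to the Euclidean norm; the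
  equivalence of the two (\<open>is_norm_equivalent\<close>) mediates.
\<close>

section \<open>Norms on a finite-dimensional space\<close>

lemma is_norm_nonneg: "is_norm N \<Longrightarrow> 0 \<le> N x"
  and is_norm_eq_0: "is_norm N \<Longrightarrow> N x = 0 \<longleftrightarrow> x = 0"
  and is_norm_scaleR: "is_norm N \<Longrightarrow> N (c *\<^sub>R x) = \<bar>c\<bar> * N x"
  and is_norm_triangle: "is_norm N \<Longrightarrow> N (x + y) \<le> N x + N y"
  by (simp_all add: is_norm_def)

lemma is_norm_minus: "is_norm N \<Longrightarrow> N (- x) = N x"
  using is_norm_scaleR[of N "-1" x] by simp

lemma convex_on_is_norm:
  assumes "is_norm N"
  shows "convex_on UNIV N"
proof (rule convex_onI)
  fix t :: real and x y
  assume "0 < t" "t < 1"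
  then show "N ((1 - t) *\<^sub>R x + t *\<^sub>R y) \<le> (1 - t) * N x + t * N y"
    using is_norm_triangle[OF assms, of "(1 - t) *\<^sub>R x" "t *\<^sub>R y"]
    by (simp add: is_norm_scaleR[OF assms])
qed simp

text \<open>A convex function on a finite-dimensional space is continuous, so \<open>N\<close> attains a positive
  minimum and a maximum on the Euclidean unit sphere; homogeneity does the rest.\<close>

lemma is_norm_equivalent:
  fixes N :: "real ^ 'd \<Rightarrow> real"
  assumes N: "is_norm N"
  obtains c C where "0 < c" "0 < C" "\<And>x. c * norm x \<le> N x" "\<And>x. N x \<le> C * norm x"
proof -
  let ?S = "sphere (0 :: real ^ 'd) 1"
  have cont: "continuous_on ?S N"
    using convex_on_continuous[OF open_UNIV convex_on_is_norm[OF N]]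
    by (rule continuous_on_subset) simp
  have ne: "?S \<noteq> {}"
    by simp
  obtain a where a: "a \<in> ?S" "\<And>x. x \<in> ?S \<Longrightarrow> N a \<le> N x"
    using continuous_attains_inf[OF compact_sphere ne cont] by blast
  obtain b where b: "b \<in> ?S" "\<And>x. x \<in> ?S \<Longrightarrow> N x \<le> N b"
    using continuous_attains_sup[OF compact_sphere ne cont] by blast
  have "N a > 0"
    using a(1) is_norm_nonneg[OF N, of a] is_norm_eq_0[OF N, of a] by force
  moreover have "N b > 0"
    using \<open>N a > 0\<close> b(2)[OF a(1)] by simp
  moreover have "N a * norm x \<le> N x \<and> N x \<le> N b * norm x" for x
  proof (cases "x = 0")
    case True
    then have "N x = 0"
      by (simp only: is_norm_eq_0[OF N])
    then show ?thesis
      using True by simp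
  next
    case False
    let ?u = "(1 / norm x) *\<^sub>R x"
    have "?u \<in> ?S"
      using False by simp
    then have "N a \<le> N ?u" "N ?u \<le> N b"
      using a(2) b(2) by blast+
    then show ?thesis
      using False by (simp add: is_norm_scaleR[OF N] field_simps)
  qed
  ultimately show thesis
    using that by blast
qed

text \<open>The supremum that defines \<open>op_norm\<close> carries information only if it ranges over a bounded set;
  boundedness holds because \<open>N\<close> is equivalent to the Euclidean norm.\<close>

lemma op_norm_bound:
  fixes N :: "real ^ 'd \<Rightarrow> real"
  assumes N: "is_norm N"
  shows "N (A *v x) \<le> op_norm N A * N x"
proof (cases "x = 0")
  case True
  then show ?thesis
    using is_norm_eq_0[OF N, of x] by simp
next
  case False
  obtain c C where c: "0 < c" "0 < C" "\<And>x. c * norm x \<le> N x" "\<And>x. N x \<le> C * norm x"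
    using is_norm_equivalent[OF N] by blast
  obtain B where B: "0 < B" "\<And>x. norm (A *v x) \<le> B * norm x"
    using linear_bounded_pos[OF matrix_vector_mul_linear[of A]] by blast
  have "N (A *v y) / N y \<le> C * B / c" for y
  proof (cases "y = 0")
    case True
    then show ?thesis
      using B c is_norm_eq_0[OF N] by simp
  next
    case False
    have "N (A *v y) \<le> C * norm (A *v y)"
      by (rule c(4))
    also have "\<dots> \<le> C * (B * norm y)"
      using B(2) c(2) by (intro mult_left_mono) auto
    also have "\<dots> = (C * B / c) * (c * norm y)"
      using c(1) by simp
    also have "\<dots> \<le> (C * B / c) * N y"
      using c B(1) by (intro mult_left_mono) auto
    finally show ?thesis
      using False is_norm_nonneg[OF N, of y] is_norm_eq_0[OF N, of y] by (simp add: divide_simps)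
  qed
  then have "bdd_above (range (\<lambda>y. N (A *v y) / N y))"
    by (rule bdd_aboveI2)
  then have "N (A *v x) / N x \<le> op_norm N A"
    unfolding op_norm_def by (rule cSUP_upper[OF UNIV_I])
  moreover have "N x > 0"
    using False is_norm_nonneg[OF N, of x] is_norm_eq_0[OF N, of x] by simp
  ultimately show ?thesis
    by (simp add: field_simps)
qed

lemma convex_norm_ball:
  assumes N: "is_norm N"
  shows "convex (norm_ball N a r)"
proof (rule convexI)
  fix x y and u v :: real
  assume xy: "x \<in> norm_ball N a r" "y \<in> norm_ball N a r" and uv: "0 \<le> u" "0 \<le> v" "u + v = 1"
  have "u *\<^sub>R x + v *\<^sub>R y - (u + v) *\<^sub>R a = u *\<^sub>R (x - a) + v *\<^sub>R (y - a)"
    by (simp add: algebra_simps)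
  then have "u *\<^sub>R x + v *\<^sub>R y - a = u *\<^sub>R (x - a) + v *\<^sub>R (y - a)"
    by (simp only: uv(3) scaleR_one)
  then have "N (u *\<^sub>R x + v *\<^sub>R y - a) \<le> u * N (x - a) + v * N (y - a)"
    using is_norm_triangle[OF N, of "u *\<^sub>R (x - a)" "v *\<^sub>R (y - a)"] uv
    by (simp add: is_norm_scaleR[OF N])
  also have "\<dots> < r"
    using xy uv unfolding norm_ball_def by (intro convex_bound_lt) auto
  finally show "u *\<^sub>R x + v *\<^sub>R y \<in> norm_ball N a r"
    by (simp add: norm_ball_def)
qed

lemma norm_ball_mono: "r \<le> s \<Longrightarrow> norm_ball N a r \<subseteq> norm_ball N a s"
  by (auto simp: norm_ball_def)

section \<open>The linearization error\<close>

text \<open>The mean value inequality for \<open>z \<mapsto> g z - g' x z\<close> on the segment from \<open>x\<close> to \<open>y\<close>, whose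
  derivative there has size at most \<open>\<omega> N (y - x)\<close>.  That inequality is used for the Euclidean norm,
  and the constant \<open>K\<close> pays for the passage to \<open>N\<close> and back.\<close>

lemma linearization_error_quadratic:
  fixes N :: "real ^ 'd \<Rightarrow> real" and g :: "real ^ 'd \<Rightarrow> real ^ 'd"
  assumes N: "is_norm N" and S: "convex S" and \<omega>: "0 \<le> \<omega>"
    and diff: "\<And>x. x \<in> S \<Longrightarrow> g differentiable (at x)"
    and lip: "\<And>x y. x \<in> S \<Longrightarrow> y \<in> S \<Longrightarrow> op_norm N (Jac g x - Jac g y) \<le> \<omega> * N (x - y)"
  obtains K where "0 \<le> K"
    "\<And>x y. x \<in> S \<Longrightarrow> y \<in> S \<Longrightarrow> N (g y - g x - Jac g x *v (y - x)) \<le> K * (N (y - x))\<^sup>2"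
proof -
  obtain c C where c: "0 < c" "0 < C" "\<And>x. c * norm x \<le> N x" "\<And>x. N x \<le> C * norm x"
    using is_norm_equivalent[OF N] by blast
  let ?D = "(C / c) * \<omega>"
  have D: "0 \<le> ?D"
    using c \<omega> by simp
  have E: "0 \<le> (C / c) * ?D"
    by (rule mult_nonneg_nonneg[OF _ D]) (use c in simp)
  have "N (g y - g x - Jac g x *v (y - x)) \<le> (C / c) * ?D * (N (y - x))\<^sup>2"
    if xy: "x \<in> S" "y \<in> S" for x y
  proof -
    let ?\<phi> = "\<lambda>z. g z - Jac g x *v z"
    let ?T = "closed_segment x y"
    have TS: "?T \<subseteq> S"
      using S xy by (simp add: closed_segment_subset)
    have deriv: "(?\<phi> has_derivative (\<lambda>v. (Jac g z - Jac g x) *v v)) (at z within ?T)"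
      if "z \<in> ?T" for z
    proof -
      have "(g has_derivative (\<lambda>v. Jac g z *v v)) (at z)"
        using diff TS that jacobian_works by blast
      then have "(?\<phi> has_derivative (\<lambda>v. Jac g z *v v - Jac g x *v v)) (at z)"
        by (intro has_derivative_diff bounded_linear_imp_has_derivative
              matrix_vector_mul_bounded_linear)
      then show ?thesis
        by (simp add: matrix_vector_mult_diff_rdistrib has_derivative_at_withinI)
    qed
    have bound: "onorm (\<lambda>v. (Jac g z - Jac g x) *v v) \<le> ?D * N (y - x)" if z: "z \<in> ?T" for z
    proof (rule onorm_bound)
      show "0 \<le> ?D * N (y - x)"
        using D is_norm_nonneg[OF N] by (rule mult_nonneg_nonneg)
      fix v
      obtain u where u: "0 \<le> u" "u \<le> 1" "z = (1 - u) *\<^sub>R x + u *\<^sub>R y"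
        using z by (auto simp: closed_segment_def)
      then have "z - x = u *\<^sub>R (y - x)"
        by (simp add: algebra_simps)
      then have "N (z - x) \<le> N (y - x)"
        using u is_norm_nonneg[OF N, of "y - x"]
        by (simp add: is_norm_scaleR[OF N] mult_left_le_one_le)
      then have op: "op_norm N (Jac g z - Jac g x) \<le> \<omega> * N (y - x)"
        using lip[of z x] z TS xy \<omega> by (meson mult_left_mono order_trans subsetD)
      have "c * norm ((Jac g z - Jac g x) *v v) \<le> N ((Jac g z - Jac g x) *v v)"
        by (rule c(3))
      also have "\<dots> \<le> op_norm N (Jac g z - Jac g x) * N v"
        by (rule op_norm_bound[OF N])
      also have "\<dots> \<le> (\<omega> * N (y - x)) * (C * norm v)"
        using op c \<omega> is_norm_nonneg[OF N] by (intro mult_mono) auto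
      finally show "norm ((Jac g z - Jac g x) *v v) \<le> ?D * N (y - x) * norm v"
        using c by (simp add: field_simps)
    qed
    have "norm (?\<phi> y - ?\<phi> x) \<le> ?D * N (y - x) * norm (y - x)"
      by (rule differentiable_bound[OF convex_closed_segment deriv bound]) auto
    moreover have "?\<phi> y - ?\<phi> x = g y - g x - Jac g x *v (y - x)"
      by (simp add: matrix_vector_mult_diff_distrib)
    ultimately have le: "norm (g y - g x - Jac g x *v (y - x)) \<le> ?D * N (y - x) * norm (y - x)"
      by simp
    have "N (g y - g x - Jac g x *v (y - x)) \<le> C * norm (g y - g x - Jac g x *v (y - x))"
      by (rule c(4))
    also have "\<dots> \<le> C * (?D * N (y - x) * norm (y - x))"
      using le c by (intro mult_left_mono) auto
    also have "\<dots> = (C / c) * ?D * N (y - x) * (c * norm (y - x))"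
      using c by simp
    also have "\<dots> \<le> (C / c) * ?D * N (y - x) * N (y - x)"
      by (rule mult_left_mono[OF c(3) mult_nonneg_nonneg[OF E is_norm_nonneg[OF N]]])
    finally show ?thesis
      by (simp add: power2_eq_square mult.assoc)
  qed
  with E show thesis
    by (rule that)
qed

section \<open>One regularized Newton step\<close>

lemma matrix_mul_matrix_inv: "invertible A \<Longrightarrow> A ** matrix_inv A = mat 1"
  unfolding invertible_def matrix_inv_def by (rule conjunct1[OF someI_ex])

lemma linearization_at_regularized_step:
  fixes J R :: "real ^ 'd ^ 'd"
  assumes "invertible (\<alpha> *\<^sub>R R + J)"
  shows "r - J *v (matrix_inv (\<alpha> *\<^sub>R R + J) *v r) = ((\<alpha> *\<^sub>R R) ** matrix_inv (\<alpha> *\<^sub>R R + J)) *v r"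
proof -
  let ?B = "matrix_inv (\<alpha> *\<^sub>R R + J)"
  have "r = ((\<alpha> *\<^sub>R R + J) ** ?B) *v r"
    using assms by (simp add: matrix_mul_matrix_inv)
  also have "\<dots> = (\<alpha> *\<^sub>R R + J) *v (?B *v r)"
    by (simp only: matrix_vector_mul_assoc)
  also have "\<dots> = ((\<alpha> *\<^sub>R R) ** ?B) *v r + J *v (?B *v r)"
    by (simp only: matrix_vector_mult_add_rdistrib flip: matrix_vector_mul_assoc)
  finally show ?thesis
    by (simp add: algebra_simps)
qed

text \<open>The new residual is the linearization at the step, of size at most \<open>q\<close> times the old residual,
  plus the quadratic linearization error.\<close>

lemma residual_after_step:
  fixes N :: "real ^ 'd \<Rightarrow> real" and g :: "real ^ 'd \<Rightarrow> real ^ 'd" and R :: "real ^ 'd ^ 'd"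
  assumes N: "is_norm N" and inv: "invertible (\<alpha> *\<^sub>R R + Jac g x)" and K: "0 \<le> K"
    and y: "y = x - matrix_inv (\<alpha> *\<^sub>R R + Jac g x) *v g x"
    and M: "op_norm N (matrix_inv (\<alpha> *\<^sub>R R + Jac g x)) \<le> M"
    and q: "op_norm N ((\<alpha> *\<^sub>R R) ** matrix_inv (\<alpha> *\<^sub>R R + Jac g x)) \<le> q"
    and lin: "N (g y - g x - Jac g x *v (y - x)) \<le> K * (N (y - x))\<^sup>2"
  shows "N (g y) \<le> (q + K * M\<^sup>2 * N (g x)) * N (g x)"
proof -
  let ?B = "matrix_inv (\<alpha> *\<^sub>R R + Jac g x)"
  let ?h = "?B *v g x"
  have step: "y - x = - ?h"
    by (simp add: y)
  have "N (y - x) = N ?h"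
    by (simp add: step is_norm_minus[OF N])
  also have "\<dots> \<le> M * N (g x)"
    using op_norm_bound[OF N, of ?B "g x"] mult_right_mono[OF M is_norm_nonneg[OF N, of "g x"]]
    by linarith
  finally have "(N (y - x))\<^sup>2 \<le> (M * N (g x))\<^sup>2"
    by (intro power_mono is_norm_nonneg[OF N])
  then have quad: "K * (N (y - x))\<^sup>2 \<le> K * (M * N (g x))\<^sup>2"
    using K by (rule mult_left_mono)
  have "g x + Jac g x *v (y - x) = ((\<alpha> *\<^sub>R R) ** ?B) *v g x"
    using linearization_at_regularized_step[OF inv, of "g x"]
    by (simp add: step linear_neg[OF matrix_vector_mul_linear])
  then have "g y = ((\<alpha> *\<^sub>R R) ** ?B) *v g x + (g y - g x - Jac g x *v (y - x))"
    by (simp add: algebra_simps)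
  then have "N (g y) \<le> N (((\<alpha> *\<^sub>R R) ** ?B) *v g x) + N (g y - g x - Jac g x *v (y - x))"
    using is_norm_triangle[OF N] by metis
  also have "N (((\<alpha> *\<^sub>R R) ** ?B) *v g x) \<le> q * N (g x)"
    using op_norm_bound[OF N, of "(\<alpha> *\<^sub>R R) ** ?B" "g x"]
      mult_right_mono[OF q is_norm_nonneg[OF N, of "g x"]]
    by linarith
  finally show ?thesis
    using lin quad by (simp add: algebra_simps power2_eq_square)
qed

section \<open>Convergence of the residual\<close>

lemma q_linear_stays_in_ball:
  assumes N: "is_norm N" and lin: "q_linear N y a" and start: "y 0 \<in> norm_ball N a r"
  shows "y n \<in> norm_ball N a r"
proof (induction n)
  case (Suc n)
  obtain \<rho> where \<rho>: "0 < \<rho>" "\<rho> < 1" "N (y (Suc n) - a) \<le> \<rho> * N (y n - a)"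
    using lin unfolding q_linear_def by blast
  then have "N (y (Suc n) - a) \<le> N (y n - a)"
    using mult_left_le_one_le[of "N (y n - a)" \<rho>] is_norm_nonneg[OF N, of "y n - a"] by simp
  then show ?case
    using Suc by (simp add: norm_ball_def)
qed (rule start)

lemma small_on_norm_ball:
  fixes N :: "real ^ 'd \<Rightarrow> real" and g :: "real ^ 'd \<Rightarrow> real ^ 'd"
  assumes N: "is_norm N" and cont: "isCont g a" and ga: "g a = 0" and \<delta>: "0 < \<delta>"
  obtains \<epsilon> where "0 < \<epsilon>" "\<And>x. x \<in> norm_ball N a \<epsilon> \<Longrightarrow> N (g x) < \<delta>"
proof -
  obtain c C where c: "0 < c" "0 < C" "\<And>x. c * norm x \<le> N x" "\<And>x. N x \<le> C * norm x"
    using is_norm_equivalent[OF N] by blast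
  have "0 < \<delta> / C"
    using \<delta> c by simp
  then obtain s where s: "0 < s" "\<And>x. dist x a < s \<Longrightarrow> norm (g x) < \<delta> / C"
    using cont ga unfolding continuous_at_eps_delta by (metis dist_0_norm dist_commute)
  have "N (g x) < \<delta>" if "x \<in> norm_ball N a (c * s)" for x
  proof -
    have "c * norm (x - a) < c * s"
      using that c(3)[of "x - a"] by (simp add: norm_ball_def)
    then have "norm (g x) < \<delta> / C"
      using s(2) c(1) by (simp add: dist_norm)
    then have "C * norm (g x) < \<delta>"
      using c(2) by (simp add: field_simps)
    then show ?thesis
      using c(4)[of "g x"] by simp
  qed
  moreover have "0 < c * s"
    using c s by simp
  ultimately show thesis
    using that by blast
qed

lemma regularization_factor_mono:
  fixes \<alpha> \<gamma> \<beta> :: real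
  assumes "0 < \<beta>" "0 < \<alpha>" "\<alpha> \<le> \<gamma>"
  shows "(\<alpha> / \<beta>) / (1 + \<alpha> / \<beta>) \<le> (\<gamma> / \<beta>) / (1 + \<gamma> / \<beta>)"
proof -
  have "t / \<beta> / (1 + t / \<beta>) = 1 - \<beta> / (\<beta> + t)" if "0 < t" for t
    using assms(1) that by (simp add: field_simps)
  moreover have "\<beta> / (\<beta> + \<gamma>) \<le> \<beta> / (\<beta> + \<alpha>)"
    using assms by (intro divide_left_mono) auto
  ultimately show ?thesis
    using assms by simp
qed

theorem theorem4p5:
  fixes N :: "real ^ 'd \<Rightarrow> real"
    and g :: "real ^ 'd \<Rightarrow> real ^ 'd"
    and xstar :: "real ^ 'd"
    and R :: "real ^ 'd ^ 'd"
    and \<alpha>\<^sub>M \<beta> \<omega>\<^sub>L M\<^sub>I \<epsilon>\<^sub>1 \<epsilon>\<^sub>E \<beta>\<^sub>S \<epsilon>\<^sub>3 :: real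
  assumes "is_norm N"
    and "\<forall>x. g differentiable (at x)"
    and "g xstar = 0"
    and "pos_semidef R"
    and "\<alpha>\<^sub>M > 0"
    and "\<beta> > 0" and "\<omega>\<^sub>L > 0" and "M\<^sub>I > 0" and "\<epsilon>\<^sub>1 > 0"
    and "\<And>\<alpha> x y. \<lbrakk>0 < \<alpha>; \<alpha> < \<alpha>\<^sub>M; x \<in> norm_ball N xstar \<epsilon>\<^sub>1; y \<in> norm_ball N xstar \<epsilon>\<^sub>1\<rbrakk> \<Longrightarrow>
           op_norm N (Jac g x - Jac g y) \<le> \<omega>\<^sub>L * N (x - y)"
    and "\<And>\<alpha> x. \<lbrakk>0 < \<alpha>; \<alpha> < \<alpha>\<^sub>M; x \<in> norm_ball N xstar \<epsilon>\<^sub>1\<rbrakk> \<Longrightarrow>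
           invertible (\<alpha> *\<^sub>R R + Jac g x)"
    and "\<And>\<alpha> x. \<lbrakk>0 < \<alpha>; \<alpha> < \<alpha>\<^sub>M; x \<in> norm_ball N xstar \<epsilon>\<^sub>1\<rbrakk> \<Longrightarrow>
           op_norm N (matrix_inv (\<alpha> *\<^sub>R R + Jac g x)) \<le> M\<^sub>I"
    and "\<And>\<alpha> x. \<lbrakk>0 < \<alpha>; \<alpha> < \<alpha>\<^sub>M; x \<in> norm_ball N xstar \<epsilon>\<^sub>1\<rbrakk> \<Longrightarrow>
           op_norm N (matrix_inv (\<alpha> *\<^sub>R R + Jac g x) ** (\<alpha> *\<^sub>R R)) \<le> (\<alpha> / \<beta>) / (1 + \<alpha> / \<beta>)"
    and "error_radius N g R \<alpha>\<^sub>M xstar \<epsilon>\<^sub>E" and "\<epsilon>\<^sub>E \<le> \<epsilon>\<^sub>1"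
    and "\<beta>\<^sub>S > 0" and "0 < \<epsilon>\<^sub>3" and "\<epsilon>\<^sub>3 \<le> \<epsilon>\<^sub>E"
    and "\<And>\<alpha> x. \<lbrakk>0 < \<alpha>; \<alpha> < \<alpha>\<^sub>M; x \<in> norm_ball N xstar \<epsilon>\<^sub>3\<rbrakk> \<Longrightarrow>
           op_norm N ((\<alpha> *\<^sub>R R) ** matrix_inv (\<alpha> *\<^sub>R R + Jac g x)) \<le> (\<alpha> / \<beta>\<^sub>S) / (1 + \<alpha> / \<beta>\<^sub>S)"
  shows "\<exists>\<epsilon>\<^sub>S > 0. \<forall>x0 \<in> norm_ball N xstar \<epsilon>\<^sub>S. \<forall>\<alpha>. (\<forall>n. 0 < \<alpha> n \<and> \<alpha> n < \<alpha>\<^sub>M) \<longrightarrow>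
           iteration_defined g R \<alpha> x0 \<and> q_linear N (\<lambda>n. g (iterate g R \<alpha> x0 n)) 0"
proof -
  note N = assms(1) and diff = assms(2) and g0 = assms(3) and \<alpha>\<^sub>M = assms(5)
    and \<omega>\<^sub>L = assms(7) and lip = assms(10) and inv = assms(11)
    and inv_bound = assms(12) and err = assms(14) and E1 = assms(15) and \<beta>\<^sub>S = assms(16)
    and \<epsilon>\<^sub>3 = assms(17) and "3E" = assms(18) and reg_bound = assms(19)
  \<comment> \<open>The Lipschitz condition is stated for each admissible \<open>\<alpha>\<close>, so one such \<open>\<alpha>\<close> must be exhibited.\<close>
  have lip': "op_norm N (Jac g x - Jac g y) \<le> \<omega>\<^sub>L * N (x - y)"
    if "x \<in> norm_ball N xstar \<epsilon>\<^sub>1" "y \<in> norm_ball N xstar \<epsilon>\<^sub>1" for x y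
    using lip[of "\<alpha>\<^sub>M / 2"] \<alpha>\<^sub>M that by simp
  obtain K where K: "0 \<le> K"
    and lin: "\<And>x y. x \<in> norm_ball N xstar \<epsilon>\<^sub>1 \<Longrightarrow> y \<in> norm_ball N xstar \<epsilon>\<^sub>1 \<Longrightarrow>
                N (g y - g x - Jac g x *v (y - x)) \<le> K * (N (y - x))\<^sup>2"
    using linearization_error_quadratic[OF N convex_norm_ball[OF N] _ _ lip'] \<omega>\<^sub>L diff
    by (metis less_imp_le)
  define q where "q = (\<alpha>\<^sub>M / \<beta>\<^sub>S) / (1 + \<alpha>\<^sub>M / \<beta>\<^sub>S)"
  have q: "0 < q" "q < 1"
    using \<alpha>\<^sub>M \<beta>\<^sub>S by (simp_all add: q_def field_simps add_pos_pos)
  \<comment> \<open>Residuals below \<open>\<delta>\<close> turn the factor \<open>q + K M\<^sub>I\<^sup>2 r\<close> of a step into one below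
     \<open>(1 + q) / 2\<close>; the summand \<open>1\<close> keeps the denominator positive when \<open>K = 0\<close>.\<close>
  define \<delta> where "\<delta> = (1 - q) / 2 / (K * M\<^sub>I\<^sup>2 + 1)"
  have KM: "0 \<le> K * M\<^sub>I\<^sup>2"
    using K by simp
  then have "0 < K * M\<^sub>I\<^sup>2 + 1"
    by linarith
  then have \<delta>: "0 < \<delta>" and \<delta>_eq: "\<delta> * (K * M\<^sub>I\<^sup>2 + 1) = (1 - q) / 2"
    using q nonzero_eq_divide_eq[THEN iffD1, OF less_imp_neq[symmetric] \<delta>_def]
    by (simp add: \<delta>_def, blast)
  have cont: "isCont g x" for x
    using diff differentiable_imp_continuous_within by blast
  obtain \<epsilon> where \<epsilon>: "0 < \<epsilon>" and small: "\<And>x. x \<in> norm_ball N xstar \<epsilon> \<Longrightarrow> N (g x) < \<delta>"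
    using small_on_norm_ball[OF N cont g0 \<delta>] by blast
  define \<epsilon>\<^sub>S where "\<epsilon>\<^sub>S = min \<epsilon> \<epsilon>\<^sub>3"
  have sub: "norm_ball N xstar \<epsilon>\<^sub>S \<subseteq> norm_ball N xstar \<epsilon>"
    "norm_ball N xstar \<epsilon>\<^sub>S \<subseteq> norm_ball N xstar \<epsilon>\<^sub>3"
    "norm_ball N xstar \<epsilon>\<^sub>S \<subseteq> norm_ball N xstar \<epsilon>\<^sub>E"
    "norm_ball N xstar \<epsilon>\<^sub>S \<subseteq> norm_ball N xstar \<epsilon>\<^sub>1"
    using E1 "3E" by (simp_all add: \<epsilon>\<^sub>S_def norm_ball_mono)
  show ?thesis
  proof (intro exI[of _ \<epsilon>\<^sub>S] conjI ballI allI impI)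
    show "0 < \<epsilon>\<^sub>S"
      using \<epsilon> \<epsilon>\<^sub>3 by (simp add: \<epsilon>\<^sub>S_def)
    fix x0 and \<alpha> :: "nat \<Rightarrow> real"
    assume x0: "x0 \<in> norm_ball N xstar \<epsilon>\<^sub>S" and \<alpha>: "\<forall>n. 0 < \<alpha> n \<and> \<alpha> n < \<alpha>\<^sub>M"
    let ?x = "iterate g R \<alpha> x0"
    have defined: "iteration_defined g R \<alpha> x0" and ql: "q_linear N ?x xstar"
      using err x0 \<alpha> sub(3) unfolding error_radius_def by blast+
    show "iteration_defined g R \<alpha> x0"
      by (rule defined)
    have ball: "?x n \<in> norm_ball N xstar \<epsilon>\<^sub>S" for n
      using q_linear_stays_in_ball[OF N ql] x0 by simp
    have contraction: "N (g (?x (Suc n))) \<le> (1 + q) / 2 * N (g (?x n))" for n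
    proof -
      have \<alpha>n: "0 < \<alpha> n" "\<alpha> n < \<alpha>\<^sub>M"
        using \<alpha> by auto
      have in_balls: "?x n \<in> norm_ball N xstar \<epsilon>" "?x n \<in> norm_ball N xstar \<epsilon>\<^sub>3"
        "?x n \<in> norm_ball N xstar \<epsilon>\<^sub>1" "?x (Suc n) \<in> norm_ball N xstar \<epsilon>\<^sub>1"
        using ball[of n] ball[of "Suc n"] sub by blast+
      have "op_norm N ((\<alpha> n *\<^sub>R R) ** matrix_inv (\<alpha> n *\<^sub>R R + Jac g (?x n))) \<le> q"
        using reg_bound[OF \<alpha>n in_balls(2)] regularization_factor_mono[OF \<beta>\<^sub>S \<alpha>n(1), of \<alpha>\<^sub>M] \<alpha>n(2)
        by (simp add: q_def)
      from residual_after_step[OF N inv[OF \<alpha>n in_balls(3)] K iterate.simps(2)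
          inv_bound[OF \<alpha>n in_balls(3)] this lin[OF in_balls(3,4)]]
      have "N (g (?x (Suc n))) \<le> (q + K * M\<^sub>I\<^sup>2 * N (g (?x n))) * N (g (?x n))" .
      moreover have "K * M\<^sub>I\<^sup>2 * N (g (?x n)) \<le> K * M\<^sub>I\<^sup>2 * \<delta>"
        using small[OF in_balls(1)] KM by (intro mult_left_mono) auto
      then have "q + K * M\<^sub>I\<^sup>2 * N (g (?x n)) \<le> (1 + q) / 2"
        using \<delta> \<delta>_eq by (simp add: algebra_simps)
      then have "(q + K * M\<^sub>I\<^sup>2 * N (g (?x n))) * N (g (?x n)) \<le> (1 + q) / 2 * N (g (?x n))"
        using is_norm_nonneg[OF N] by (rule mult_right_mono)
      ultimately show ?thesis
        by linarith
    qed
    have "?x \<longlonglongrightarrow> xstar"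
      using ql by (simp add: q_linear_def)
    then have "(\<lambda>n. g (?x n)) \<longlonglongrightarrow> 0"
      using isCont_tendsto_compose[OF cont, of ?x xstar sequentially] g0 by simp
    then show "q_linear N (\<lambda>n. g (?x n)) 0"
      using contraction q unfolding q_linear_def
      by (intro conjI exI[of _ "(1 + q) / 2"]) auto
  qed
qed

end
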